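(* Let $T$ be a tree with at least two edges. Then $$\mu\bigl(L(L(T))\bigr)\ge\left\lfloor\frac{\Delta(T)^2}{3}\right\rfloor.$$ Moreover, this bound is sharp, i.e. there exists a tree $T$ with at least two edges for which equality holds.
   Context: All graphs are finite, simple, undirected and connected. A tree is a connected graph with no cycles. $\Delta(G)$ denotes the maximum degree of $G$. For a graph $G$ and $X\subseteq V(G)$, two vertices $u,v$ are $X$-visible if there is a shortest $(u,v)$-path in $G$ all of whose internal vertices lie outside $X$. A set $X\subseteq V(G)$ is a mutual-visibility set of $G$ if every pair of vertices of $X$ is $X$-visible. The mutual-visibility number $\mu(G)$ is the maximum cardinality of a mutual-visibility set of $G$. The line graph $L(G)$ has vertex set $E(G)$, two vertices being adjacent if and only if the corresponding (distinct) edges of $G$ share an endpoint; $L(L(G))$ is the iterated line graph. *)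

theory Defs
  imports Complex_Main
begin

record 'a ugraph =
  verts :: "'a set"
  edges :: "'a set set"

definition simple_graph :: "'a ugraph \<Rightarrow> bool" where
  "simple_graph G \<longleftrightarrow> finite (verts G) \<and> (\<forall>e\<in>edges G. e \<subseteq> verts G \<and> card e = 2)"

definition adj :: "'a ugraph \<Rightarrow> 'a \<Rightarrow> 'a \<Rightarrow> bool" where
  "adj G u v \<longleftrightarrow> {u, v} \<in> edges G"

definition degree :: "'a ugraph \<Rightarrow> 'a \<Rightarrow> nat" where
  "degree G v = card {e \<in> edges G. v \<in> e}"

definition max_degree :: "'a ugraph \<Rightarrow> nat" where
  "max_degree G = Max (degree G ` verts G)"

definition is_path :: "'a ugraph \<Rightarrow> 'a list \<Rightarrow> bool" where
  "is_path G p \<longleftrightarrow> p \<noteq> [] \<and> set p \<subseteq> verts G \<and> distinct p \<and> successively (adj G) p"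

definition path_between :: "'a ugraph \<Rightarrow> 'a \<Rightarrow> 'a \<Rightarrow> 'a list \<Rightarrow> bool" where
  "path_between G u v p \<longleftrightarrow> is_path G p \<and> hd p = u \<and> last p = v"

text \<open>The length of \<open>p\<close> as a path is \<open>length p - 1\<close>, so comparing list lengths is enough here.\<close>

definition shortest_path :: "'a ugraph \<Rightarrow> 'a \<Rightarrow> 'a \<Rightarrow> 'a list \<Rightarrow> bool" where
  "shortest_path G u v p \<longleftrightarrow>
     path_between G u v p \<and> (\<forall>q. path_between G u v q \<longrightarrow> length p \<le> length q)"

definition internal_verts :: "'a list \<Rightarrow> 'a set" where
  "internal_verts p = set (butlast (tl p))"

definition connected_graph :: "'a ugraph \<Rightarrow> bool" where
  "connected_graph G \<longleftrightarrow>
     verts G \<noteq> {} \<and> (\<forall>u\<in>verts G. \<forall>v\<in>verts G. \<exists>p. path_between G u v p)"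

definition is_cycle :: "'a ugraph \<Rightarrow> 'a list \<Rightarrow> bool" where
  "is_cycle G c \<longleftrightarrow> is_path G c \<and> 3 \<le> length c \<and> adj G (last c) (hd c)"

definition is_tree :: "'a ugraph \<Rightarrow> bool" where
  "is_tree G \<longleftrightarrow> simple_graph G \<and> connected_graph G \<and> (\<nexists>c. is_cycle G c)"

definition line_graph :: "'a ugraph \<Rightarrow> 'a set ugraph" where
  "line_graph G =
     \<lparr> verts = edges G,
       edges = {{e, f} | e f. e \<in> edges G \<and> f \<in> edges G \<and> e \<noteq> f \<and> e \<inter> f \<noteq> {}} \<rparr>"

lemma simple_graph_line_graph:
  assumes "simple_graph G"
  shows "simple_graph (line_graph G)"
proof -
  have "edges G \<subseteq> Pow (verts G)" and "finite (verts G)"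
    using assms by (auto simp: simple_graph_def)
  then have "finite (edges G)"
    by (meson finite_Pow_iff finite_subset)
  moreover have "d \<subseteq> edges G \<and> card d = 2" if "d \<in> edges (line_graph G)" for d
  proof -
    from that obtain e f where "d = {e, f}" "e \<in> edges G" "f \<in> edges G" "e \<noteq> f"
      unfolding line_graph_def by (simp only: ugraph.simps) blast
    then show ?thesis
      by simp
  qed
  ultimately show ?thesis
    by (simp add: simple_graph_def) (simp add: line_graph_def)
qed

definition visible :: "'a ugraph \<Rightarrow> 'a set \<Rightarrow> 'a \<Rightarrow> 'a \<Rightarrow> bool" where
  "visible G X u v \<longleftrightarrow> (\<exists>p. shortest_path G u v p \<and> internal_verts p \<inter> X = {})"

definition mutual_visibility_set :: "'a ugraph \<Rightarrow> 'a set \<Rightarrow> bool" where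
  "mutual_visibility_set G X \<longleftrightarrow> X \<subseteq> verts G \<and> (\<forall>u\<in>X. \<forall>v\<in>X. visible G X u v)"

definition mutual_visibility_number :: "'a ugraph \<Rightarrow> nat" where
  "mutual_visibility_number G = Max {card X | X. mutual_visibility_set G X}"

end

(*
  The cherries centred at a vertex v of maximum degree n are the edges of the clique K_n that the
  edges at v form in L(T). Two disjoint edges ab, cd of a clique are at distance 2 in the line
  graph, with middle vertices ac, ad, bc, bd, so a set X of edges of the clique is a
  mutual-visibility set as soon as X contains no K_4. The balanced complete tripartite Turan graph
  has floor(n^2/3) edges. For sharpness the path with two edges suffices, since its iterated line
  graph is a single vertex.
*)
theory Submission imports Defs begin

section \<open>Line graphs and bounds on the mutual-visibility number\<close>

lemma verts_line_graph [simp]: "verts (line_graph G) = edges G"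
  by (simp add: line_graph_def)

lemma adj_line_graph:
  "adj (line_graph G) e f \<longleftrightarrow> e \<in> edges G \<and> f \<in> edges G \<and> e \<noteq> f \<and> e \<inter> f \<noteq> {}"
  unfolding adj_def line_graph_def by (auto simp: doubleton_eq_iff)

text \<open>Finiteness is what makes the \<open>Max\<close> in
  \<open>mutual_visibility_number\<close> meaningful; the sets counted are all subsets of the vertex
  set.\<close>

lemma finite_mutual_visibility_cards:
  assumes "finite (verts G)"
  shows "finite {card X | X. mutual_visibility_set G X}"
proof -
  have "{card X | X. mutual_visibility_set G X} \<subseteq> card ` Pow (verts G)"
    by (auto simp: mutual_visibility_set_def)
  then show ?thesis
    using assms by (meson finite_Pow_iff finite_imageI finite_subset)
qed

lemma card_le_mutual_visibility_number:
  assumes "finite (verts G)" "mutual_visibility_set G X"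
  shows "card X \<le> mutual_visibility_number G"
  unfolding mutual_visibility_number_def
  using assms by (intro Max_ge finite_mutual_visibility_cards) auto

lemma mutual_visibility_number_le_card_verts:
  assumes "finite (verts G)"
  shows "mutual_visibility_number G \<le> card (verts G)"
proof -
  \<comment> \<open>The empty set shows that \<open>Max\<close> is taken over a nonempty
    set.\<close>
  have "mutual_visibility_set G {}"
    by (simp add: mutual_visibility_set_def)
  then have "{card X | X. mutual_visibility_set G X} \<noteq> {}"
    by blast
  then show ?thesis
    unfolding mutual_visibility_number_def
    using assms finite_mutual_visibility_cards[OF assms]
    by (auto simp: mutual_visibility_set_def intro: card_mono)
qed

section \<open>Visibility at distance at most 2\<close>

lemma visible_refl:
  assumes "u \<in> verts G"
  shows "visible G X u u"
proof -
  have "shortest_path G u u [u]"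
    using assms by (auto simp: shortest_path_def path_between_def is_path_def Suc_le_eq)
  then show ?thesis
    by (auto simp: visible_def internal_verts_def)
qed

lemma path_between_length_ge_2:
  assumes "path_between G u v q" "u \<noteq> v"
  shows "2 \<le> length q"
  using assms by (cases q rule: remdups_adj.cases) (auto simp: path_between_def is_path_def)

lemma path_between_length_ge_3:
  assumes "path_between G u v q" "u \<noteq> v" "\<not> adj G u v"
  shows "3 \<le> length q"
proof (rule ccontr)
  assume "\<not> 3 \<le> length q"
  with path_between_length_ge_2[OF assms(1,2)] have "length q = 2"
    by simp
  then obtain x y where "q = [x, y]"
    by (auto simp: length_Suc_conv numeral_2_eq_2)
  then show False
    using assms by (auto simp: path_between_def is_path_def)
qed

lemma visible_adj:
  assumes "u \<in> verts G" "v \<in> verts G" "u \<noteq> v" "adj G u v"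
  shows "visible G X u v"
proof -
  have "path_between G u v [u, v]"
    using assms by (simp add: path_between_def is_path_def)
  then have "shortest_path G u v [u, v]"
    using assms path_between_length_ge_2[of G u v] by (simp add: shortest_path_def numeral_2_eq_2)
  then show ?thesis
    by (auto simp: visible_def internal_verts_def)
qed

text \<open>Non-adjacency puts \<open>u\<close> and \<open>v\<close> at distance exactly 2, so the
  path through \<open>m\<close> is shortest, and \<open>m\<close> is its only internal
  vertex.\<close>

lemma visible_common_neighbour:
  assumes "{u, m, v} \<subseteq> verts G" "distinct [u, m, v]" "adj G u m" "adj G m v" "\<not> adj G u v"
    and "m \<notin> X"
  shows "visible G X u v"
proof -
  have "path_between G u v [u, m, v]"
    using assms by (simp add: path_between_def is_path_def)
  then have "shortest_path G u v [u, m, v]"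
    using assms path_between_length_ge_3[of G u v] by (simp add: shortest_path_def numeral_3_eq_3)
  then show ?thesis
    using assms(6) by (force simp: visible_def internal_verts_def)
qed

section \<open>Balanced complete tripartite graphs\<close>

text \<open>The complete multipartite graph on \<open>S\<close> whose parts are the colour classes
  of \<open>c\<close>. Its edges are two-element sets, so inside a clique of \<open>G\<close> they
  are vertices of \<open>line_graph G\<close>.\<close>

definition multipartite_edges :: "'a set \<Rightarrow> ('a \<Rightarrow> nat) \<Rightarrow> 'a set set" where
  "multipartite_edges S c = {{x, y} | x y. x \<in> S \<and> y \<in> S \<and> c x \<noteq> c y}"

lemma doubleton_in_multipartite_edges_iff:
  "{x, y} \<in> multipartite_edges S c \<longleftrightarrow> x \<in> S \<and> y \<in> S \<and> c x \<noteq> c y"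
  unfolding multipartite_edges_def by (auto simp: doubleton_eq_iff)

text \<open>Counts the earlier vertices in the part of a new vertex \<open>n\<close>: they are
  \<open>3 * k + n mod 3\<close> for \<open>k < n div 3\<close>.\<close>

lemma card_same_residue_mod_3:
  "card {i. i < n \<and> i mod 3 = n mod (3::nat)} = n div 3"
proof -
  have "{i. i < n \<and> i mod 3 = n mod 3} = (\<lambda>k. 3 * k + n mod 3) ` {..<n div 3}"
  proof (intro equalityI subsetI)
    fix i assume "i \<in> {i. i < n \<and> i mod 3 = n mod 3}"
    then have "i < n" "i mod 3 = n mod 3"
      by simp_all
    then have "i = 3 * (i div 3) + n mod 3" "i div 3 < n div 3"
      using mult_div_mod_eq[of 3 i] mult_div_mod_eq[of 3 n] by linarith+
    then show "i \<in> (\<lambda>k. 3 * k + n mod 3) ` {..<n div 3}"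
      by blast
  next
    fix i assume "i \<in> (\<lambda>k. 3 * k + n mod 3) ` {..<n div 3}"
    then obtain k where "k < n div 3" "i = 3 * k + n mod 3"
      by blast
    then have "i < n" "i mod 3 = n mod 3"
      by (linarith, simp)
    then show "i \<in> {i. i < n \<and> i mod 3 = n mod 3}"
      by simp
  qed
  then show ?thesis
    by (simp add: card_image inj_on_def)
qed

lemma card_different_residue_mod_3:
  "card {i. i < n \<and> i mod 3 \<noteq> n mod (3::nat)} = n - n div 3"
proof -
  have "{i. i < n \<and> i mod 3 \<noteq> n mod 3} = {..<n} - {i. i < n \<and> i mod 3 = n mod 3}"
    by auto
  then show ?thesis
    by (simp add: card_Diff_subset card_same_residue_mod_3 subset_iff)
qed

text \<open>The increment \<open>n - n div 3\<close> is the number of edges from a new vertex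
  \<open>n\<close> to the earlier vertices in the other two parts.\<close>

lemma Suc_square_div_3: "(Suc n)\<^sup>2 div 3 = n\<^sup>2 div 3 + (n - n div 3)"
proof -
  \<comment> \<open>Naming the square \<open>m\<close> leaves terms linear in \<open>m\<close> and
    \<open>q\<close>, within reach of linear arithmetic.\<close>
  define q m where "q = n div 3" and "m = q * q"
  then consider "n = 3 * q" | "n = 3 * q + 1" | "n = 3 * q + 2"
    by linarith
  then show ?thesis
  proof cases
    case 1
    then have "n\<^sup>2 = 9 * m" "(Suc n)\<^sup>2 = 9 * m + 6 * q + 1"
      by (simp_all add: m_def power2_eq_square algebra_simps)
    then show ?thesis
      using 1 by simp
  next
    case 2
    then have "n\<^sup>2 = 9 * m + 6 * q + 1" "(Suc n)\<^sup>2 = 9 * m + 12 * q + 4"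
      by (simp_all add: m_def power2_eq_square algebra_simps)
    moreover have "(9 * m + 6 * q + 1) div 3 = 3 * m + 2 * q" "(9 * m + 12 * q + 4) div 3 = 3 * m + 4 * q + 1"
      by linarith+
    ultimately show ?thesis
      using 2 by simp
  next
    case 3
    then have "n\<^sup>2 = 9 * m + 12 * q + 4" "(Suc n)\<^sup>2 = 9 * m + 18 * q + 9"
      by (simp_all add: m_def power2_eq_square algebra_simps)
    moreover have "(9 * m + 12 * q + 4) div 3 = 3 * m + 4 * q + 1" "(9 * m + 18 * q + 9) div 3 = 3 * m + 6 * q + 3"
      by linarith+
    ultimately show ?thesis
      using 3 by simp
  qed
qed

text \<open>Numbering \<open>S\<close> and colouring by residues mod 3 gives three parts whose sizes
  differ by at most one. The edges are counted by adding the vertices one at a time.\<close>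

lemma card_balanced_tripartite_edges:
  assumes "finite S"
  shows "\<exists>c. (\<forall>x. c x < 3) \<and> card (multipartite_edges S c) = (card S)\<^sup>2 div 3"
proof -
  obtain g where g: "bij_betw g S {0..<card S}"
    using assms ex_bij_betw_finite_nat by blast
  define c where "c x = g x mod 3" for x
  have nat: "card (multipartite_edges {0..<n} (\<lambda>i. i mod 3)) = n\<^sup>2 div 3" for n :: nat
  proof (induction n)
    case 0
    show ?case
      by (simp add: multipartite_edges_def)
  next
    case (Suc n)
    let ?E = "\<lambda>n. multipartite_edges {0..<n} (\<lambda>i. i mod 3)"
    let ?new = "(\<lambda>i. {i, n}) ` {i. i < n \<and> i mod 3 \<noteq> n mod 3}"
    \<comment> \<open>The new edges are those joining the vertex \<open>n\<close> to smaller numbers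
      of a different residue.\<close>
    have "?E (Suc n) = ?E n \<union> ?new"
    proof (intro equalityI subsetI)
      fix e assume "e \<in> ?E (Suc n)"
      then obtain i j where e: "e = {i, j}" "i mod 3 \<noteq> j mod 3" "i \<le> n" "j \<le> n"
        unfolding multipartite_edges_def by fastforce
      then consider "i < n" "j < n" | "i < n" "j = n" | "i = n" "j < n"
        by (metis nat_less_le)
      then show "e \<in> ?E n \<union> ?new"
      proof cases
        case 1
        with e show ?thesis
          by (simp add: doubleton_in_multipartite_edges_iff)
      next
        case 2
        with e show ?thesis
          by blast
      next
        case 3
        with e have "e = {j, n}" "j mod 3 \<noteq> n mod 3"
          by (simp_all add: insert_commute)
        with 3 show ?thesis
          by blast
      qed
    next
      fix e assume "e \<in> ?E n \<union> ?new"
      then obtain i j where "e = {i, j}" "i mod 3 \<noteq> j mod 3" "i \<le> n" "j \<le> n"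
        unfolding multipartite_edges_def by fastforce
      then show "e \<in> ?E (Suc n)"
        by (simp add: doubleton_in_multipartite_edges_iff)
    qed
    moreover have "?E n \<inter> ?new = {}"
      by (auto simp: multipartite_edges_def doubleton_eq_iff)
    moreover have "?E n \<subseteq> Pow {0..<n}"
      by (auto simp: multipartite_edges_def)
    then have "finite (?E n)"
      by (rule finite_subset) simp
    moreover have "inj_on (\<lambda>i. {i, n}) {i. i < n \<and> i mod 3 \<noteq> n mod 3}"
      by (auto simp: inj_on_def doubleton_eq_iff)
    then have "card ?new = n - n div 3"
      by (simp add: card_image card_different_residue_mod_3)
    ultimately show ?case
      using Suc.IH by (simp add: card_Un_disjoint Suc_square_div_3)
  qed
  \<comment> \<open>The numbering \<open>g\<close> acts on subsets of \<open>S\<close>; restricted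
    to edges it carries the count on \<open>{0..<card S}\<close> back to \<open>S\<close>.\<close>
  have "bij_betw ((`) g) (multipartite_edges S c) (multipartite_edges {0..<card S} (\<lambda>i. i mod 3))"
  proof (rule bij_betw_subset[OF bij_betw_Pow[OF g]])
    show "multipartite_edges S c \<subseteq> Pow S"
      by (auto simp: multipartite_edges_def)
    have "multipartite_edges (g ` S) (\<lambda>i. i mod 3) = (`) g ` multipartite_edges S c"
    proof (intro equalityI subsetI)
      fix e assume "e \<in> multipartite_edges (g ` S) (\<lambda>i. i mod 3)"
      then obtain x y where "e = g ` {x, y}" "x \<in> S" "y \<in> S" "c x \<noteq> c y"
        unfolding multipartite_edges_def c_def by fastforce
      then show "e \<in> (`) g ` multipartite_edges S c"
        using doubleton_in_multipartite_edges_iff[of x y S c] by blast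
    next
      fix e assume "e \<in> (`) g ` multipartite_edges S c"
      then obtain x y where "e = g ` {x, y}" "x \<in> S" "y \<in> S" "c x \<noteq> c y"
        unfolding multipartite_edges_def by blast
      then show "e \<in> multipartite_edges (g ` S) (\<lambda>i. i mod 3)"
        by (simp add: doubleton_in_multipartite_edges_iff c_def)
    qed
    then show "(`) g ` multipartite_edges S c = multipartite_edges {0..<card S} (\<lambda>i. i mod 3)"
      using g by (simp add: bij_betw_def)
  qed
  then have "card (multipartite_edges S c) = (card S)\<^sup>2 div 3"
    by (simp add: bij_betw_same_card nat)
  then show ?thesis
    by (intro exI[of _ c]) (simp add: c_def)
qed

section \<open>Mutual visibility in the line graph of a clique\<close>

text \<open>Only disjoint edges need an argument. With three colours they have ends of equal colour,
  and the clique edge joining those ends lies outside the set and meets both edges.\<close>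

lemma mutual_visibility_set_tripartite_edges:
  assumes clique: "\<And>x y. x \<in> S \<Longrightarrow> y \<in> S \<Longrightarrow> x \<noteq> y \<Longrightarrow> adj G x y"
    and c: "\<And>x. c x < 3"
  shows "mutual_visibility_set (line_graph G) (multipartite_edges S c)" (is "mutual_visibility_set ?L ?X")
  unfolding mutual_visibility_set_def
proof (intro conjI ballI)
  show sub: "?X \<subseteq> verts ?L"
    using clique by (auto simp: multipartite_edges_def adj_def)
  fix u w assume uw: "u \<in> ?X" "w \<in> ?X"
  consider "u = w" | "u \<noteq> w" "u \<inter> w \<noteq> {}" | "u \<inter> w = {}"
    by blast
  then show "visible ?L ?X u w"
  proof cases
    case 1
    then show ?thesis
      using sub uw by (blast intro: visible_refl)
  next
    case 2
    then show ?thesis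
      using sub uw by (intro visible_adj) (auto simp: adj_line_graph)
  next
    case 3
    obtain x y where u: "u = {x, y}" "x \<in> S" "y \<in> S" "c x \<noteq> c y"
      using uw(1) unfolding multipartite_edges_def by blast
    obtain z t where w: "w = {z, t}" "z \<in> S" "t \<in> S" "c z \<noteq> c t"
      using uw(2) unfolding multipartite_edges_def by blast
    \<comment> \<open>Pigeonhole: two pairs of distinct colours out of three share a colour.\<close>
    have "c x = c z \<or> c x = c t \<or> c y = c z \<or> c y = c t"
      using c[of x] c[of y] c[of z] c[of t] u(4) w(4) by linarith
    then obtain a b where ab: "a \<in> u" "b \<in> w" "c a = c b"
      using u(1) w(1) by blast
    have S: "a \<in> S" "b \<in> S" "a \<noteq> b"
      using ab u w 3 by auto
    have "{a, b} \<in> edges G"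
      using clique[OF S] by (simp add: adj_def)
    moreover have "{a, b} \<notin> ?X"
      using ab(3) by (simp add: doubleton_in_multipartite_edges_iff)
    moreover have "u \<in> edges G" "w \<in> edges G"
      using sub uw by auto
    moreover have "u \<noteq> {a, b}" "{a, b} \<noteq> w" "u \<noteq> w"
      using 3 ab u(1) by auto
    ultimately show ?thesis
      using 3 ab by (intro visible_common_neighbour[where m = "{a, b}"]) (auto simp: adj_line_graph)
  qed
qed

lemma mutual_visibility_number_line_graph_ge:
  assumes "finite (edges G)" "finite S"
    and clique: "\<And>x y. x \<in> S \<Longrightarrow> y \<in> S \<Longrightarrow> x \<noteq> y \<Longrightarrow> adj G x y"
  shows "(card S)\<^sup>2 div 3 \<le> mutual_visibility_number (line_graph G)"
proof -
  obtain c where "\<forall>x. c x < 3" and card: "card (multipartite_edges S c) = (card S)\<^sup>2 div 3"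
    using card_balanced_tripartite_edges[OF assms(2)] by blast
  then have "mutual_visibility_set (line_graph G) (multipartite_edges S c)"
    using clique by (intro mutual_visibility_set_tripartite_edges) auto
  then show ?thesis
    using card card_le_mutual_visibility_number[of "line_graph G"] assms(1) by fastforce
qed

lemma simple_graph_finite_edges:
  assumes "simple_graph G"
  shows "finite (edges G)"
  using simple_graph_line_graph[OF assms] by (simp add: simple_graph_def)

text \<open>The edges at a vertex of maximum degree pairwise share that vertex, so they form a
  clique of \<open>line_graph G\<close>, to which the bound for cliques applies.\<close>

lemma mutual_visibility_number_line_line_graph_ge:
  assumes "simple_graph G" "verts G \<noteq> {}"
  shows "(max_degree G)\<^sup>2 div 3 \<le> mutual_visibility_number (line_graph (line_graph G))"
proof -
  have "max_degree G \<in> degree G ` verts G"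
    unfolding max_degree_def using assms by (intro Max_in) (auto simp: simple_graph_def)
  then obtain v where v: "max_degree G = card {e \<in> edges G. v \<in> e}"
    by (auto simp: degree_def)
  have "finite (edges (line_graph G))"
    using assms(1) by (intro simple_graph_finite_edges simple_graph_line_graph)
  \<comment> \<open>Rewriting with \<open>v\<close> exposes the star at \<open>v\<close> as the
    clique \<open>S\<close>.\<close>
  then show ?thesis
    unfolding v using simple_graph_finite_edges[OF assms(1)]
    by (intro mutual_visibility_number_line_graph_ge) (auto simp: adj_line_graph)
qed

section \<open>Sharpness: the path with two edges and centre 0\<close>

definition path3 :: "nat ugraph" where
  "path3 = \<lparr> verts = {0, 1, 2}, edges = {{0, 1}, {0, 2}} \<rparr>"

lemma adj_path3: "adj path3 u v \<longleftrightarrow> u = 0 \<and> v \<in> {1, 2} \<or> v = 0 \<and> u \<in> {1, 2}"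
  by (auto simp: adj_def path3_def doubleton_eq_iff)

lemma is_tree_path3: "is_tree path3"
  unfolding is_tree_def
proof (intro conjI)
  show "simple_graph path3"
    by (simp add: simple_graph_def path3_def)
  have "\<exists>p. path_between path3 u v p" if "u \<in> {0, 1, 2}" "v \<in> {0, 1, 2}" for u v
  proof -
    consider "u = v" | "u \<noteq> v" "u = 0 \<or> v = 0" | "u \<noteq> v" "u \<noteq> 0" "v \<noteq> 0"
      by blast
    then show ?thesis
    proof cases
      case 1
      then show ?thesis
        using that by (intro exI[of _ "[u]"]) (auto simp: path_between_def is_path_def path3_def)
    next
      case 2
      then show ?thesis
        using that
        by (intro exI[of _ "[u, v]"]) (auto simp: path_between_def is_path_def adj_path3, auto simp: path3_def)
    next
      case 3
      then show ?thesis
        using that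
        by (intro exI[of _ "[u, 0, v]"]) (auto simp: path_between_def is_path_def adj_path3, auto simp: path3_def)
    qed
  qed
  then show "connected_graph path3"
    by (simp add: connected_graph_def path3_def)
  show "\<nexists>c. is_cycle path3 c"
  proof
    assume "\<exists>c. is_cycle path3 c"
    then obtain c where c: "is_path path3 c" "3 \<le> length c" "adj path3 (last c) (hd c)"
      by (auto simp: is_cycle_def)
    then have "card (set c) = length c" "set c \<subseteq> {0, 1, 2}"
      by (auto simp: is_path_def distinct_card path3_def)
    then have "length c \<le> card {0, 1, 2 :: nat}"
      by (metis card_mono finite.emptyI finite.insertI)
    with c(2) have "length c = 3"
      by simp
    then obtain x y z where "c = [x, y, z]"
      by (auto simp: length_Suc_conv numeral_3_eq_3)
    \<comment> \<open>A cycle would be a triangle on all three vertices, but every edge of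
      \<open>path3\<close> contains 0, so 1 and 2 are not adjacent.\<close>
    with c show False
      by (auto simp: is_path_def adj_path3)
  qed
qed

lemma max_degree_path3: "max_degree path3 = 2"
proof -
  have "{e \<in> edges path3. 0 \<in> e} = {{0, 1}, {0, 2}}" "{e \<in> edges path3. 1 \<in> e} = {{0, 1}}"
    "{e \<in> edges path3. 2 \<in> e} = {{0, 2}}"
    by (auto simp: path3_def)
  then have "degree path3 0 = 2" "degree path3 1 = 1" "degree path3 2 = 1"
    unfolding degree_def by (simp_all add: doubleton_eq_iff)
  moreover have "verts path3 = {0, 1, 2}"
    by (simp add: path3_def)
  ultimately show ?thesis
    by (simp add: max_degree_def)
qed

text \<open>Makes the iterated line graph of \<open>path3\<close> a single vertex, which bounds its
  mutual-visibility number by 1.\<close>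

lemma edges_line_graph_two_edges:
  assumes "edges G = {e, f}" "e \<noteq> f" "e \<inter> f \<noteq> {}"
  shows "edges (line_graph G) = {{e, f}}"
proof -
  have "f \<inter> e \<noteq> {}"
    using assms(3) by blast
  with assms show ?thesis
    unfolding line_graph_def by (simp add: set_eq_iff[where A = "Collect _"]) (metis insert_commute)
qed

theorem theorem17:
  "(\<forall>T :: 'a ugraph. is_tree T \<longrightarrow> card (edges T) \<ge> 2 \<longrightarrow>
      int (mutual_visibility_number (line_graph (line_graph T)))
        \<ge> \<lfloor>(real (max_degree T))\<^sup>2 / 3\<rfloor>) \<and>
   (\<exists>T :: nat ugraph. is_tree T \<and> card (edges T) \<ge> 2 \<and>
      int (mutual_visibility_number (line_graph (line_graph T)))
        = \<lfloor>(real (max_degree T))\<^sup>2 / 3\<rfloor>)"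
proof -
  have floor: "\<lfloor>(real n)\<^sup>2 / 3\<rfloor> = int (n\<^sup>2 div 3)" for n
    using floor_divide_of_nat_eq[where 'a = real, of "n\<^sup>2" 3] by simp
  have bound: "\<lfloor>(real (max_degree T))\<^sup>2 / 3\<rfloor> \<le> int (mutual_visibility_number (line_graph (line_graph T)))"
    if "is_tree T" for T :: "'a ugraph"
    using mutual_visibility_number_line_line_graph_ge[of T] that
    unfolding floor by (simp add: is_tree_def connected_graph_def)
  have "mutual_visibility_number (line_graph (line_graph path3)) \<le> 1"
    using mutual_visibility_number_le_card_verts[of "line_graph (line_graph path3)"]
      edges_line_graph_two_edges[of path3 "{0, 1}" "{0, 2}"]
    by (simp add: path3_def doubleton_eq_iff)
  \<comment> \<open>The general lower bound for maximum degree 2 is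
    \<open>2\<^sup>2 div 3 = 1\<close>, matching the upper bound.\<close>
  then have "int (mutual_visibility_number (line_graph (line_graph path3))) = \<lfloor>(real (max_degree path3))\<^sup>2 / 3\<rfloor>"
    using mutual_visibility_number_line_line_graph_ge[of path3] is_tree_path3
    unfolding floor by (simp add: max_degree_path3 is_tree_def connected_graph_def)
  moreover have "card (edges path3) \<ge> 2"
    by (simp add: path3_def doubleton_eq_iff)
  ultimately show ?thesis
    using bound is_tree_path3 by blast
qed

end
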